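(* Consider a linear quantum system with $n$ oscillators and $m$ input channels and parameters $(S,C_-,C_+,\Omega_-,\Omega_+)$ (all notation as in the context). Suppose that both $S$ and $\Omega$ are purely imaginary and that $\mathcal{C}$ is real or purely imaginary. Then quantum BAE measurements of $\mathbf{q}_{\rm out}$ with respect to $\mathbf{q}_{\rm in}$ and of $\mathbf{p}_{\rm out}$ with respect to $\mathbf{p}_{\rm in}$ are realized, i.e. $\mathbb{G}_{\mathbf{q}_{\rm in}\to\mathbf{q}_{\rm out}}[s]\equiv 0$ and $\mathbb{G}_{\mathbf{p}_{\rm in}\to\mathbf{p}_{\rm out}}[s]\equiv 0$. If further (i) $C_-=C_+$ (so that $\mathbf{q}$ is coupled with the environment), then $\mathbf{q}$ is a QND variable if the subsystem $(\imath(\Omega_-+\Omega_+),0,C_-)$ is observable; (ii) $C_-=-C_+$ (so that $\mathbf{p}$ is coupled with the environment), then $\mathbf{p}$ is a QND variable if the subsystem $(\imath(\Omega_--\Omega_+),0,C_-)$ is observable.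
   Context: $\imath=\sqrt{-1}$; $X^\#$ is the entrywise complex conjugate (adjoint, for operator entries), $X^\dagger=(X^\#)^\top$; $\Delta(U,V)=\begin{bmatrix} U & V \\ V^\# & U^\# \end{bmatrix}$; $J_k=\mathrm{diag}(I_k,-I_k)$; for $X\in\mathbf{C}^{2k\times 2r}$, $X^\flat=J_rX^\dagger J_k$; $V_k=\frac1{\sqrt2}\begin{bmatrix} I_k & I_k \\ -\imath I_k & \imath I_k \end{bmatrix}$. A matrix is purely imaginary if its real part is zero. A linear quantum system is specified by: a unitary $S\in\mathbf{C}^{m\times m}$; matrices $C_-,C_+\in\mathbf{C}^{m\times n}$, with $\mathcal{C}=\Delta(C_-,C_+)$; and $\Omega_-,\Omega_+\in\mathbf{C}^{n\times n}$ such that $\Omega=\Delta(\Omega_-,\Omega_+)$ is Hermitian (equivalently $\Omega_-$ Hermitian, $\Omega_+$ symmetric). The coupling operator is $\mathbf{L}=C_-\mathbf{a}+C_+\mathbf{a}^\#$ and the Hamiltonian is $\mathbf{H}=\frac12\begin{bmatrix} \mathbf{a} \\ \mathbf{a}^\# \end{bmatrix}^\dagger\Omega\begin{bmatrix} \mathbf{a} \\ \mathbf{a}^\# \end{bmatrix}$, where $\mathbf{a}=(\mathbf{a}_1,\dots,\mathbf{a}_n)^\top$ are annihilation operators. In real quadrature form the system is $$\dot{\mathbf{x}}=\mathbb{A}\mathbf{x}+\mathbb{B}\mathbf{u},\qquad \mathbf{y}=\mathbb{C}\mathbf{x}+\mathbb{D}\mathbf{u},\qquad \mathbf{x}=\begin{bmatrix}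 \mathbf{q} \\ \mathbf{p} \end{bmatrix},\ \mathbf{u}=\begin{bmatrix} \mathbf{q}_{\rm in} \\ \mathbf{p}_{\rm in} \end{bmatrix},\ \mathbf{y}=\begin{bmatrix} \mathbf{q}_{\rm out} \\ \mathbf{p}_{\rm out} \end{bmatrix},$$ where $\mathbb{D}=V_m\Delta(S,0)V_m^\dagger$, $\mathbb{C}=V_m\mathcal{C}V_n^\dagger$, $\mathbb{B}=-V_n\mathcal{C}^\flat\Delta(S,0)V_m^\dagger$, $\mathbb{A}=V_n\left(-\imath J_n\Omega-\frac12\mathcal{C}^\flat\mathcal{C}\right)V_n^\dagger$ are real matrices. The transfer matrix is $\mathbb{G}[s]=\mathbb{D}+\mathbb{C}(sI-\mathbb{A})^{-1}\mathbb{B}$, partitioned into four $m\times m$ blocks conformably with $\mathbf{u}$ and $\mathbf{y}$; e.g. $\mathbb{G}_{\mathbf{q}_{\rm in}\to\mathbf{q}_{\rm out}}$ is the $(1,1)$ block and $\mathbb{G}_{\mathbf{p}_{\rm in}\to\mathbf{p}_{\rm out}}$ is the $(2,2)$ block. A BAE measurement of an output quadrature with respect to an input quadrature is realized when the corresponding transfer block vanishes identically. A vector of system variables $\mathbf{z}=T\mathbf{x}$ ($T$ a real matrix) is a QND variable if it evolves autonomously and independently of the inputs ($T\mathbb{A}=FT$ for some matrix $F$, and $T\mathbb{B}=0$; in particular it is uncontrollable) and is observable from the output (the rows of $T$ lie in the row space of the observability matrix of $(\mathbb{A},\mathbb{C})$). A subsystem $(A,0,C)$ is observable if the pair $(A,C)$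 is observable in the usual sense. *)

theory Defs
  imports "HOL-Analysis.Analysis"
begin

text \<open>
  A \<open>k \<times> r\<close> matrix is an element of \<open>'a ^ 'r ^ 'k\<close>; doubled-up \<open>2k \<times> 2r\<close> matrices are indexed
  by the sum types \<open>'k + 'k\<close> and \<open>'r + 'r\<close>, where \<open>Inl\<close> is the first block and \<open>Inr\<close> the second.
  Beware that \<open>*\<close> and \<open>^\<close> are entrywise on \<open>vec\<close>; the matrix product is \<open>**\<close>.
\<close>

definition block_mat ::
    "'a ^ 'c ^ 'r \<Rightarrow> 'a ^ 'd ^ 'r \<Rightarrow> 'a ^ 'c ^ 's \<Rightarrow> 'a ^ 'd ^ 's \<Rightarrow> 'a ^ ('c::finite + 'd::finite) ^ ('r::finite + 's::finite)" where
  "block_mat A B C D = (\<chi> i j. case i of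
      Inl k \<Rightarrow> (case j of Inl l \<Rightarrow> A $ k $ l | Inr l \<Rightarrow> B $ k $ l)
    | Inr k \<Rightarrow> (case j of Inl l \<Rightarrow> C $ k $ l | Inr l \<Rightarrow> D $ k $ l))"

definition block11 :: "'a ^ ('c::finite + 'd::finite) ^ ('r::finite + 's::finite) \<Rightarrow> 'a ^ 'c ^ 'r" where
  "block11 M = (\<chi> i j. M $ Inl i $ Inl j)"

definition block22 :: "'a ^ ('c::finite + 'd::finite) ^ ('r::finite + 's::finite) \<Rightarrow> 'a ^ 'd ^ 's" where
  "block22 M = (\<chi> i j. M $ Inr i $ Inr j)"

definition mat_scale :: "'a::times \<Rightarrow> 'a ^ 'c ^ 'r \<Rightarrow> 'a ^ 'c ^ 'r" where
  "mat_scale c = map_matrix ((*) c)"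

definition mat_cnj :: "complex ^ 'c ^ 'r \<Rightarrow> complex ^ 'c ^ 'r" where
  "mat_cnj = map_matrix cnj"

definition dagger :: "complex ^ 'c ^ 'r \<Rightarrow> complex ^ 'r ^ 'c" where
  "dagger X = transpose (mat_cnj X)"

definition mat_Re :: "complex ^ 'c ^ 'r \<Rightarrow> real ^ 'c ^ 'r" where
  "mat_Re = map_matrix Re"

definition mat_of_real :: "real ^ 'c ^ 'r \<Rightarrow> complex ^ 'c ^ 'r" where
  "mat_of_real = map_matrix complex_of_real"

definition real_mat :: "complex ^ 'c ^ 'r \<Rightarrow> bool" where
  "real_mat X \<longleftrightarrow> (\<forall>i j. Im (X $ i $ j) = 0)"

definition imag_mat :: "complex ^ 'c ^ 'r \<Rightarrow> bool" where
  "imag_mat X \<longleftrightarrow> (\<forall>i j. Re (X $ i $ j) = 0)"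

definition hermitian_mat :: "complex ^ 'k ^ 'k \<Rightarrow> bool" where
  "hermitian_mat X \<longleftrightarrow> dagger X = X"

definition unitary_mat :: "complex ^ 'k ^ 'k \<Rightarrow> bool" where
  "unitary_mat X \<longleftrightarrow> dagger X ** X = mat 1 \<and> X ** dagger X = mat 1"

definition Delta :: "complex ^ 'r ^ 'k \<Rightarrow> complex ^ 'r ^ 'k \<Rightarrow> complex ^ ('r::finite + 'r::finite) ^ ('k::finite + 'k::finite)" where
  "Delta U V = block_mat U V (mat_cnj V) (mat_cnj U)"

definition Jmat :: "complex ^ ('k::finite + 'k::finite) ^ ('k::finite + 'k::finite)" where
  "Jmat = block_mat (mat 1) 0 0 (- mat 1)"

definition flat_adj :: "complex ^ ('r::finite + 'r::finite) ^ ('k::finite + 'k::finite) \<Rightarrow> complex ^ ('k::finite + 'k::finite) ^ ('r::finite + 'r::finite)" where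
  "flat_adj X = Jmat ** dagger X ** Jmat"

definition Vmat :: "complex ^ ('k::finite + 'k::finite) ^ ('k::finite + 'k::finite)" where
  "Vmat = mat_scale (1 / complex_of_real (sqrt 2))
            (block_mat (mat 1) (mat 1) (mat (- \<i>)) (mat \<i>))"


section \<open>Linear quantum systems\<close>

text \<open>
  Parameters are passed in the order \<open>S, C\<^sub>-, C\<^sub>+, \<Omega>\<^sub>-, \<Omega>\<^sub>+\<close>; the coupling matrices
  and \<open>\<Omega>\<close> enter through \<open>Delta Cm Cp\<close> and \<open>Delta Om Op\<close>.
\<close>

definition linear_quantum_system ::
    "complex ^ 'm ^ 'm \<Rightarrow> complex ^ 'n ^ 'm \<Rightarrow> complex ^ 'n ^ 'm \<Rightarrow>
     complex ^ 'n ^ 'n \<Rightarrow> complex ^ 'n ^ 'n \<Rightarrow> bool" where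
  "linear_quantum_system S Cm Cp Om Op \<longleftrightarrow> unitary_mat S \<and> hermitian_mat (Delta Om Op)"

definition quad_A_complex ::
    "complex ^ 'n ^ 'm \<Rightarrow> complex ^ 'n ^ 'm \<Rightarrow> complex ^ 'n ^ 'n \<Rightarrow> complex ^ 'n ^ 'n \<Rightarrow>
     complex ^ ('n::finite + 'n::finite) ^ ('n::finite + 'n::finite)" where
  "quad_A_complex Cm Cp Om Op =
     Vmat ** (mat_scale (- \<i>) (Jmat ** Delta Om Op)
              - mat_scale (1/2) (flat_adj (Delta Cm Cp) ** Delta Cm Cp)) ** dagger Vmat"

definition quad_B_complex ::
    "complex ^ 'm ^ 'm \<Rightarrow> complex ^ 'n ^ 'm \<Rightarrow> complex ^ 'n ^ 'm \<Rightarrow>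
     complex ^ ('m::finite + 'm::finite) ^ ('n::finite + 'n::finite)" where
  "quad_B_complex S Cm Cp = - (Vmat ** flat_adj (Delta Cm Cp) ** Delta S 0 ** dagger Vmat)"

definition quad_C_complex ::
    "complex ^ 'n ^ 'm \<Rightarrow> complex ^ 'n ^ 'm \<Rightarrow> complex ^ ('n::finite + 'n::finite) ^ ('m::finite + 'm::finite)" where
  "quad_C_complex Cm Cp = Vmat ** Delta Cm Cp ** dagger Vmat"

definition quad_D_complex :: "complex ^ 'm ^ 'm \<Rightarrow> complex ^ ('m::finite + 'm::finite) ^ ('m::finite + 'm::finite)" where
  "quad_D_complex S = Vmat ** Delta S 0 ** dagger Vmat"

text \<open>
  These four matrices have real entries for all parameters (lemma \<open>quad_real\<close> below), so that
  taking real parts only changes the type of the entries.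
\<close>

definition quad_A where "quad_A Cm Cp Om Op = mat_Re (quad_A_complex Cm Cp Om Op)"
definition quad_B where "quad_B S Cm Cp = mat_Re (quad_B_complex S Cm Cp)"
definition quad_C where "quad_C Cm Cp = mat_Re (quad_C_complex Cm Cp)"
definition quad_D where "quad_D S = mat_Re (quad_D_complex S)"

lemma sum_UNIV_Plus: "sum f (UNIV :: ('a::finite + 'b::finite) set) = (\<Sum>i\<in>UNIV. f (Inl i)) + (\<Sum>i\<in>UNIV. f (Inr i))"
  by (simp add: UNIV_Plus_UNIV[symmetric] sum.Plus del: UNIV_Plus_UNIV)

lemma block_mat_mult:
  fixes A :: "'a::comm_ring_1 ^ 'c ^ 'r"
  shows "block_mat A B C D ** block_mat A' B' C' D' =
    block_mat (A ** A' + B ** C') (A ** B' + B ** D') (C ** A' + D ** C') (C ** B' + D ** D')"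
  by (auto simp: vec_eq_iff block_mat_def matrix_matrix_mult_def sum_UNIV_Plus split: sum.splits)

lemma mat_mult_left: "mat c ** A = mat_scale c A" for A :: "'a::comm_ring_1 ^ 'c ^ 'r"
  by (simp add: vec_eq_iff mat_scale_def matrix_matrix_mult_def mat_def if_distrib if_distribR cong: if_cong)

lemma mat_mult_right: "A ** mat c = mat_scale c A" for A :: "'a::comm_ring_1 ^ 'c ^ 'r"
  by (simp add: vec_eq_iff mat_scale_def matrix_matrix_mult_def mat_def if_distrib if_distribR
      mult.commute cong: if_cong)

lemma mat_scale_mult: "mat_scale c A ** B = mat_scale c (A ** B)" "A ** mat_scale c B = mat_scale c (A ** B)"
  for A :: "'a::comm_ring_1 ^ 'c ^ 'r"
  by (simp_all add: vec_eq_iff mat_scale_def matrix_matrix_mult_def sum_distrib_left ac_simps)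

lemma mat_cnj_mult: "mat_cnj (A ** B) = mat_cnj A ** mat_cnj B"
  by (simp add: vec_eq_iff mat_cnj_def matrix_matrix_mult_def)

lemma Delta_mult:
  "Delta U V ** Delta U' V' = Delta (U ** U' + V ** mat_cnj V') (U ** V' + V ** mat_cnj U')"
proof -
  have cnj: "mat_cnj (A + B) = mat_cnj A + mat_cnj B" "mat_cnj (mat_cnj A) = A" for A B :: "complex ^ 'x ^ 'y"
    by (simp_all add: vec_eq_iff mat_cnj_def)
  show ?thesis
    by (simp add: Delta_def block_mat_mult mat_cnj_mult cnj add.commute)
qed

lemma dagger_block_mat:
  "dagger (block_mat A B C D) = block_mat (dagger A) (dagger C) (dagger B) (dagger D)"
  by (auto simp: vec_eq_iff dagger_def mat_cnj_def transpose_def block_mat_def split: sum.splits)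

lemma flat_adj_Delta: "flat_adj (Delta U V) = Delta (dagger U) (- transpose V)"
proof -
  have neg: "- (mat 1 :: complex ^ 'x ^ 'x) = mat (- 1)"
    by (simp add: vec_eq_iff mat_def)
  show ?thesis
    by (simp add: flat_adj_def Delta_def Jmat_def dagger_block_mat block_mat_mult mat_mult_left mat_mult_right neg)
       (simp add: vec_eq_iff block_mat_def mat_scale_def dagger_def mat_cnj_def transpose_def split: sum.splits)
qed

lemma minus_i_Jmat_Delta:
  "mat_scale (- \<i>) (Jmat ** Delta U V) = Delta (mat_scale (- \<i>) U) (mat_scale (- \<i>) V)"
proof -
  have neg: "- (mat 1 :: complex ^ 'x ^ 'x) = mat (- 1)"
    by (simp add: vec_eq_iff mat_def)
  show ?thesis
    by (simp add: Delta_def Jmat_def block_mat_mult mat_mult_left neg)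
       (simp add: vec_eq_iff block_mat_def mat_scale_def mat_cnj_def split: sum.splits)
qed

lemma Delta_diff_half:
  "Delta U V - mat_scale (1/2) (Delta U' V') = Delta (U - mat_scale (1/2) U') (V - mat_scale (1/2) V')"
  by (auto simp: vec_eq_iff Delta_def block_mat_def mat_cnj_def mat_scale_def split: sum.splits)

lemma Vmat_Delta_Vmat:
  "Vmat ** Delta U V ** dagger Vmat = mat_of_real (block_mat
     (\<chi> i j. Re (U $ i $ j) + Re (V $ i $ j)) (\<chi> i j. Im (V $ i $ j) - Im (U $ i $ j))
     (\<chi> i j. Im (U $ i $ j) + Im (V $ i $ j)) (\<chi> i j. Re (U $ i $ j) - Re (V $ i $ j)))"
proof -
  have dm: "dagger (mat c) = mat (cnj c)" for c :: complex
    by (simp add: vec_eq_iff dagger_def mat_cnj_def transpose_def mat_def)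
  have ds: "dagger (mat_scale c A) = mat_scale (cnj c) (dagger A)" for c and A :: "complex ^ 'x ^ 'y"
    by (simp add: vec_eq_iff dagger_def mat_cnj_def transpose_def mat_scale_def)
  have ss: "mat_scale a (mat_scale b A) = mat_scale (a * b) A" for a b and A :: "complex ^ 'x ^ 'y"
    by (simp add: vec_eq_iff mat_scale_def ac_simps)
  have h: "complex_of_real (1 / sqrt 2) * complex_of_real (1 / sqrt 2) = 1 / 2"
    by (simp only: of_real_mult[symmetric]) simp
  have h': "1 / complex_of_real (sqrt 2) = complex_of_real (1 / sqrt 2)" by simp
  show ?thesis
    unfolding Vmat_def h' ds mat_scale_mult ss dagger_block_mat dm Delta_def block_mat_mult
      complex_cnj_complex_of_real h
    by (simp only: mat_mult_left mat_mult_right)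
       (auto simp: vec_eq_iff mat_scale_def mat_cnj_def mat_of_real_def block_mat_def complex_eq_iff
         algebra_simps split: sum.splits)
qed

lemma quad_real:
  "mat_of_real (quad_A Cm Cp Om Op) = quad_A_complex Cm Cp Om Op"
  "mat_of_real (quad_B S Cm Cp) = quad_B_complex S Cm Cp"
  "mat_of_real (quad_C Cm Cp) = quad_C_complex Cm Cp"
  "mat_of_real (quad_D S) = quad_D_complex S"
proof -
  have ReR: "mat_Re (mat_of_real M) = M" for M :: "real ^ 'x ^ 'y"
    by (simp add: vec_eq_iff mat_Re_def mat_of_real_def)
  have neg: "- mat_of_real M = mat_of_real (- M)" for M :: "real ^ 'x ^ 'y"
    by (simp add: vec_eq_iff mat_of_real_def)
  show "mat_of_real (quad_A Cm Cp Om Op) = quad_A_complex Cm Cp Om Op"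
    by (simp only: quad_A_def quad_A_complex_def minus_i_Jmat_Delta flat_adj_Delta Delta_mult
        Delta_diff_half Vmat_Delta_Vmat ReR)
  show "mat_of_real (quad_B S Cm Cp) = quad_B_complex S Cm Cp"
  proof -
    have "Vmat ** flat_adj (Delta Cm Cp) ** Delta S 0 ** dagger Vmat =
        Vmat ** (flat_adj (Delta Cm Cp) ** Delta S 0) ** dagger Vmat"
      by (simp only: matrix_mul_assoc)
    then show ?thesis
      by (simp only: quad_B_def quad_B_complex_def flat_adj_Delta Delta_mult Vmat_Delta_Vmat neg ReR)
  qed
  show "mat_of_real (quad_C Cm Cp) = quad_C_complex Cm Cp"
    by (simp only: quad_C_def quad_C_complex_def Vmat_Delta_Vmat ReR)
  show "mat_of_real (quad_D S) = quad_D_complex S"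
    by (simp only: quad_D_def quad_D_complex_def Vmat_Delta_Vmat ReR)
qed

definition transfer_matrix ::
    "complex ^ 'm ^ 'm \<Rightarrow> complex ^ 'n ^ 'm \<Rightarrow> complex ^ 'n ^ 'm \<Rightarrow>
     complex ^ 'n ^ 'n \<Rightarrow> complex ^ 'n ^ 'n \<Rightarrow> complex \<Rightarrow> complex ^ ('m::finite + 'm::finite) ^ ('m::finite + 'm::finite)" where
  "transfer_matrix S Cm Cp Om Op s =
     mat_of_real (quad_D S) + mat_of_real (quad_C Cm Cp)
       ** matrix_inv (mat s - mat_of_real (quad_A Cm Cp Om Op)) ** mat_of_real (quad_B S Cm Cp)"

text \<open>
  \<open>matrix_inv\<close> is unspecified on singular matrices, so \<open>transfer_matrix\<close> is meaningful only where
  the resolvent exists, that is, away from the finitely many eigenvalues of \<open>quad_A\<close>.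
\<close>

definition transfer_defined ::
    "complex ^ 'n ^ 'm \<Rightarrow> complex ^ 'n ^ 'm \<Rightarrow> complex ^ 'n ^ 'n \<Rightarrow> complex ^ 'n ^ 'n \<Rightarrow> complex \<Rightarrow> bool" where
  "transfer_defined Cm Cp Om Op s \<longleftrightarrow> invertible (mat s - mat_of_real (quad_A Cm Cp Om Op))"

definition BAE_q_out_wrt_q_in where
  "BAE_q_out_wrt_q_in S Cm Cp Om Op \<longleftrightarrow>
     (\<forall>s. transfer_defined Cm Cp Om Op s \<longrightarrow> block11 (transfer_matrix S Cm Cp Om Op s) = 0)"

definition BAE_p_out_wrt_p_in where
  "BAE_p_out_wrt_p_in S Cm Cp Om Op \<longleftrightarrow>
     (\<forall>s. transfer_defined Cm Cp Om Op s \<longrightarrow> block22 (transfer_matrix S Cm Cp Om Op s) = 0)"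


section \<open>Observability and QND variables\<close>

primrec mat_pow :: "'a::semiring_1 ^ 'k ^ 'k \<Rightarrow> nat \<Rightarrow> 'a ^ 'k ^ 'k" where
  "mat_pow A 0 = mat 1"
| "mat_pow A (Suc k) = A ** mat_pow A k"

text \<open>The rows of the observability matrix, i.e. of \<open>C, CA, \<dots>, CA\<^bsup>k-1\<^esup>\<close> stacked, with \<open>A\<close> of size \<open>k\<close>.\<close>

definition observability_rows :: "'a::field ^ 'k ^ 'k \<Rightarrow> 'a ^ 'k ^ 'l \<Rightarrow> ('a ^ 'k) set" where
  "observability_rows A C = (\<Union>j<CARD('k). rows (C ** mat_pow A j))"

text \<open>
  Full column rank of the observability matrix; compare \<open>rank A = vec.dim (rows A)\<close>.
\<close>

definition observable_pair :: "'a::field ^ 'k ^ 'k \<Rightarrow> 'a ^ 'k ^ 'l \<Rightarrow> bool" where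
  "observable_pair A C \<longleftrightarrow> vec.dim (observability_rows A C) = CARD('k)"

definition QND_variable ::
    "real ^ 'k ^ 'k \<Rightarrow> real ^ 'u ^ 'k \<Rightarrow> real ^ 'k ^ 'y \<Rightarrow> real ^ 'k ^ 'z \<Rightarrow> bool" where
  "QND_variable A B C T \<longleftrightarrow>
     (\<exists>F. T ** A = F ** T) \<and> T ** B = 0 \<and> rows T \<subseteq> vec.span (observability_rows A C)"

text \<open>The matrices \<open>T\<close> with \<open>q = T x\<close> and \<open>p = T x\<close>, where \<open>x = (q, p)\<close>.\<close>

definition q_select :: "real ^ ('n::finite + 'n::finite) ^ 'n" where
  "q_select = (\<chi> i j. if j = Inl i then 1 else 0)"

definition p_select :: "real ^ ('n::finite + 'n::finite) ^ 'n" where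
  "p_select = (\<chi> i j. if j = Inr i then 1 else 0)"

end

theory Submission
  imports Defs
begin

text \<open>
  Conjugation by \<open>V\<close> turns entrywise complex conjugation of doubled-up matrices into conjugation by
  \<open>J\<close>. Hence, writing \<open>A, B, C, D\<close> for the quadrature matrices, \<open>A\<close> commutes with \<open>J\<close>, \<open>D\<close>
  anticommutes with it, and of \<open>B\<close> and \<open>C\<close> one commutes and the other anticommutes, so the transfer
  matrix anticommutes with \<open>J\<close> and its diagonal blocks vanish. If \<open>C\<^sub>- = \<plusminus>C\<^sub>+\<close>, the damping term
  \<open>flat_adj (Delta C\<^sub>- C\<^sub>+) ** Delta C\<^sub>- C\<^sub>+\<close> vanishes; the coupled quadrature then evolves under
  \<open>Im (\<Omega>\<^sub>- \<plusminus> \<Omega>\<^sub>+)\<close> alone, is not driven by the input, and is the only one seen by the output, so that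
  its observability is inherited from the complex pair by taking real and imaginary parts of rows.
\<close>

section \<open>Parity of the quadrature matrices\<close>

lemma mat_cnj_uminus: "mat_cnj (- X) = - mat_cnj X"
  by (simp add: vec_eq_iff mat_cnj_def)

lemma mat_cnj_add: "mat_cnj (X + Y) = mat_cnj X + mat_cnj Y"
  by (simp add: vec_eq_iff mat_cnj_def)

lemma mat_cnj_diff: "mat_cnj (X - Y) = mat_cnj X - mat_cnj Y"
  by (simp add: vec_eq_iff mat_cnj_def)

lemma mat_cnj_mat_scale: "mat_cnj (mat_scale c X) = mat_scale (cnj c) (mat_cnj X)"
  by (simp add: vec_eq_iff mat_cnj_def mat_scale_def)

lemma mat_cnj_zero [simp]: "mat_cnj 0 = 0"
  by (simp add: vec_eq_iff mat_cnj_def)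

lemma mat_cnj_Delta: "mat_cnj (Delta U V) = Delta (mat_cnj U) (mat_cnj V)"
  by (auto simp: vec_eq_iff Delta_def block_mat_def mat_cnj_def split: sum.splits)

lemma mat_cnj_dagger: "mat_cnj (dagger X) = dagger (mat_cnj X)"
  by (simp add: vec_eq_iff dagger_def mat_cnj_def transpose_def)

lemma mat_cnj_transpose: "mat_cnj (transpose X) = transpose (mat_cnj X)"
  by (simp add: vec_eq_iff mat_cnj_def transpose_def)

lemma real_mat_iff_mat_cnj: "real_mat X \<longleftrightarrow> mat_cnj X = X"
  by (simp add: real_mat_def mat_cnj_def vec_eq_iff complex_eq_iff)

lemma imag_mat_iff_mat_cnj: "imag_mat X \<longleftrightarrow> mat_cnj X = - X"
  by (simp add: imag_mat_def mat_cnj_def vec_eq_iff complex_eq_iff)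

lemma Delta_eq_iff: "Delta U V = Delta U' V' \<longleftrightarrow> U = U' \<and> V = V'"
proof
  assume eq: "Delta U V = Delta U' V'"
  have "U $ i $ j = U' $ i $ j" "V $ i $ j = V' $ i $ j" for i j
    using arg_cong[OF eq, of "\<lambda>M. M $ Inl i $ Inl j"] arg_cong[OF eq, of "\<lambda>M. M $ Inl i $ Inr j"]
    by (simp_all add: Delta_def block_mat_def)
  then show "U = U' \<and> V = V'" by (simp add: vec_eq_iff)
qed simp

lemma Delta_uminus: "- Delta U V = Delta (- U) (- V)"
  by (auto simp: vec_eq_iff Delta_def block_mat_def mat_cnj_def split: sum.splits)

lemma real_mat_Delta: "real_mat (Delta U V) \<longleftrightarrow> mat_cnj U = U \<and> mat_cnj V = V"
  by (simp add: real_mat_iff_mat_cnj mat_cnj_Delta Delta_eq_iff)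

lemma imag_mat_Delta: "imag_mat (Delta U V) \<longleftrightarrow> mat_cnj U = - U \<and> mat_cnj V = - V"
  by (simp add: imag_mat_iff_mat_cnj mat_cnj_Delta Delta_uminus Delta_eq_iff)

lemma matrix_mul_uminus: "(- A) ** B = - (A ** B)" "A ** (- B) = - (A ** B)"
  for A :: "'a::comm_ring_1 ^ 'c ^ 'r"
  by (simp_all add: vec_eq_iff matrix_matrix_mult_def sum_negf)

lemma matrix_add_rdistrib: "(A + B) ** C = A ** C + B ** C"
  for A :: "'a::comm_ring_1 ^ 'c ^ 'r"
  by (simp add: vec_eq_iff matrix_matrix_mult_def algebra_simps sum.distrib)

lemma matrix_mul_diff: "A ** (B - C) = A ** B - A ** C" "(B - C) ** D = B ** D - C ** D"
  for A :: "'a::comm_ring_1 ^ 'c ^ 'r"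
  by (simp_all add: vec_eq_iff matrix_matrix_mult_def algebra_simps sum_subtractf)

section \<open>Parity under conjugation by \<open>Jmat\<close>\<close>

text \<open>Even matrices under this conjugation are thus the block diagonal ones, odd matrices the
  block antidiagonal ones.\<close>

lemma Jmat_block_mat_Jmat:
  "Jmat ** block_mat A B C D ** Jmat = block_mat A (- B) (- C) D"
proof -
  have neg: "- (mat 1 :: complex ^ 'x ^ 'x) = mat (- 1)"
    by (simp add: vec_eq_iff mat_def)
  show ?thesis
    by (simp add: Jmat_def neg block_mat_mult mat_mult_left mat_mult_right)
       (simp add: vec_eq_iff block_mat_def mat_scale_def split: sum.splits)
qed

lemma Jmat_Jmat: "Jmat ** Jmat = (mat 1 :: complex ^ ('a::finite + 'a) ^ ('a + 'a))"
proof -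
  have "block_mat (mat 1) 0 0 (mat 1) = (mat 1 :: complex ^ ('a + 'a) ^ ('a + 'a))"
    by (auto simp: vec_eq_iff block_mat_def mat_def split: sum.split)
  then show ?thesis
    using Jmat_block_mat_Jmat[of "mat 1 :: complex ^ 'a ^ 'a" 0 0 "mat 1"] by simp
qed

text \<open>In quadrature form the diagonal blocks carry real parts and the off-diagonal blocks
  imaginary parts, so negating the latter amounts to conjugating \<open>U\<close> and
  \<open>V\<close>.\<close>

lemma Jmat_Vmat_Delta:
  "Jmat ** (Vmat ** Delta U V ** dagger Vmat) ** Jmat
    = Vmat ** Delta (mat_cnj U) (mat_cnj V) ** dagger Vmat"
proof -
  have of_real: "mat_of_real (block_mat A B C D)
      = block_mat (mat_of_real A) (mat_of_real B) (mat_of_real C) (mat_of_real D)"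
    for A B C D :: "real ^ 'x ^ 'y"
    by (auto simp: vec_eq_iff mat_of_real_def block_mat_def split: sum.splits)
  show ?thesis
    unfolding Vmat_Delta_Vmat of_real Jmat_block_mat_Jmat
    by (auto simp: vec_eq_iff mat_of_real_def block_mat_def mat_cnj_def split: sum.splits)
qed

text \<open>The scalar factor minus i also changes sign under conjugation; the minus signs on
  \<open>Om\<close> and \<open>Op\<close> absorb this.\<close>

lemma Jmat_quad_A_complex:
  "Jmat ** quad_A_complex Cm Cp Om Op ** Jmat
    = quad_A_complex (mat_cnj Cm) (mat_cnj Cp) (- mat_cnj Om) (- mat_cnj Op)"
proof -
  have "mat_scale \<i> (mat_cnj U) = mat_scale (- \<i>) (- mat_cnj U)" for U :: "complex ^ 'x ^ 'y"
    by (simp add: vec_eq_iff mat_scale_def)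
  from this[of Om] this[of Op] show ?thesis
    by (simp add: quad_A_complex_def minus_i_Jmat_Delta flat_adj_Delta Delta_mult Delta_diff_half
        Jmat_Vmat_Delta mat_cnj_diff mat_cnj_mat_scale mat_cnj_mult mat_cnj_dagger
        mat_cnj_transpose mat_cnj_uminus mat_cnj_add)
qed

text \<open>Merging the two middle factors into one \<open>Delta\<close> makes the parity rule
  \<open>Jmat_Vmat_Delta\<close> applicable.\<close>

lemma quad_B_complex_alt:
  "quad_B_complex S Cm Cp =
    - (Vmat ** Delta (dagger Cm ** S) (- (transpose Cp ** mat_cnj S)) ** dagger Vmat)"
proof -
  have "Vmat ** flat_adj (Delta Cm Cp) ** Delta S 0 ** dagger Vmat =
      Vmat ** (flat_adj (Delta Cm Cp) ** Delta S 0) ** dagger Vmat"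
    by (simp only: matrix_mul_assoc)
  then show ?thesis
    by (simp add: quad_B_complex_def flat_adj_Delta Delta_mult matrix_mul_uminus)
qed

lemma Jmat_quad_B_complex:
  "Jmat ** quad_B_complex S Cm Cp ** Jmat = quad_B_complex (mat_cnj S) (mat_cnj Cm) (mat_cnj Cp)"
  by (simp add: quad_B_complex_alt matrix_mul_uminus Jmat_Vmat_Delta mat_cnj_mult mat_cnj_dagger
      mat_cnj_transpose mat_cnj_uminus)

lemma Jmat_quad_C_complex:
  "Jmat ** quad_C_complex Cm Cp ** Jmat = quad_C_complex (mat_cnj Cm) (mat_cnj Cp)"
  by (simp add: quad_C_complex_def Jmat_Vmat_Delta)

lemma Jmat_quad_D_complex:
  "Jmat ** quad_D_complex S ** Jmat = quad_D_complex (mat_cnj S)"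
  by (simp add: quad_D_complex_def Jmat_Vmat_Delta)

text \<open>The coupling enters the dynamics quadratically, so its sign cancels; this is why an
  imaginary coupling serves as well as a real one.\<close>

lemma quad_A_complex_uminus_C: "quad_A_complex (- Cm) (- Cp) Om Op = quad_A_complex Cm Cp Om Op"
proof -
  have "flat_adj (- X) ** (- X) = flat_adj X ** X" for X :: "complex ^ ('x::finite + 'x) ^ ('y::finite + 'y)"
  proof -
    have "dagger (- X) = - dagger X"
      by (simp add: vec_eq_iff dagger_def mat_cnj_def transpose_def)
    then show ?thesis by (simp add: flat_adj_def matrix_mul_uminus)
  qed
  note uminus = this
  show ?thesis
    by (simp only: quad_A_complex_def Delta_uminus[symmetric] uminus)
qed

lemma quad_B_complex_uminus:
  "quad_B_complex (- S) Cm Cp = - quad_B_complex S Cm Cp"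
  "quad_B_complex S (- Cm) (- Cp) = - quad_B_complex S Cm Cp"
proof -
  have t: "dagger (- X) = - dagger X" "transpose (- X) = - transpose X" for X :: "complex ^ 'x ^ 'y"
    by (simp_all add: vec_eq_iff dagger_def mat_cnj_def transpose_def)
  show "quad_B_complex (- S) Cm Cp = - quad_B_complex S Cm Cp"
    "quad_B_complex S (- Cm) (- Cp) = - quad_B_complex S Cm Cp"
    by (simp_all only: quad_B_complex_alt t matrix_mul_uminus mat_cnj_uminus Delta_uminus[symmetric])
qed

lemma quad_C_complex_uminus: "quad_C_complex (- Cm) (- Cp) = - quad_C_complex Cm Cp"
  by (simp add: quad_C_complex_def matrix_mul_uminus flip: Delta_uminus)

lemma quad_D_complex_uminus: "quad_D_complex (- S) = - quad_D_complex S"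
proof -
  have "Delta (- S) 0 = - Delta S 0" by (simp add: Delta_uminus)
  then show ?thesis by (simp add: quad_D_complex_def matrix_mul_uminus)
qed

section \<open>Parity of the resolvent and of the transfer matrix\<close>

lemma matrix_inv_conj_involution:
  fixes M J :: "'a::field ^ 'k ^ 'k"
  assumes "invertible M" and J: "J ** J = mat 1" and M: "J ** M ** J = M"
  shows "J ** matrix_inv M ** J = matrix_inv M"
proof -
  \<comment> \<open>\<open>matrix_inv\<close> is a Hilbert choice; its two laws come from the
    invertibility of \<open>M\<close>.\<close>
  have inv: "M ** matrix_inv M = mat 1" "matrix_inv M ** M = mat 1"
    using someI_ex[OF \<open>invertible M\<close>[unfolded invertible_def]] by (simp_all add: matrix_inv_def)
  have MJ: "M ** J = J ** M"
    by (metis J M matrix_mul_assoc matrix_mul_rid)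
  \<comment> \<open>Inserted on the right, \<open>M\<close> moves left past \<open>J\<close> and
    cancels against its inverse, leaving \<open>J ** J\<close>.\<close>
  have "J ** matrix_inv M ** J = J ** matrix_inv M ** J ** (M ** matrix_inv M)"
    by (simp add: inv)
  also have "\<dots> = J ** (matrix_inv M ** M) ** J ** matrix_inv M"
    by (metis MJ matrix_mul_assoc)
  also have "\<dots> = matrix_inv M" by (simp add: inv J)
  finally show ?thesis .
qed

text \<open>Conjugation fixes the diagonal blocks, so oddness makes each of them equal to its own
  negative.\<close>

lemma block_diag_eq_0_if_odd:
  fixes M :: "complex ^ ('n::finite + 'n) ^ ('m::finite + 'm)"
  assumes "Jmat ** M ** Jmat = - M"
  shows "block11 M = 0" and "block22 M = 0"
proof -
  define B :: "complex ^ 'n ^ 'm" where "B = (\<chi> i j. M $ Inl i $ Inr j)"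
  define C :: "complex ^ 'n ^ 'm" where "C = (\<chi> i j. M $ Inr i $ Inl j)"
  have "M = block_mat (block11 M) B C (block22 M)"
    by (auto simp: vec_eq_iff block_mat_def block11_def block22_def B_def C_def split: sum.splits)
  then have eq: "block_mat (block11 M) (- B) (- C) (block22 M) = - M"
    using assms Jmat_block_mat_Jmat by metis
  show "block11 M = 0"
    using arg_cong[OF eq, of "\<lambda>M. M $ Inl i $ Inl j" for i j]
    by (simp add: vec_eq_iff block_mat_def block11_def)
  show "block22 M = 0"
    using arg_cong[OF eq, of "\<lambda>M. M $ Inr i $ Inr j" for i j]
    by (simp add: vec_eq_iff block_mat_def block22_def)
qed

lemma transfer_matrix_odd:
  assumes S: "imag_mat S" and Om: "imag_mat (Delta Om Op)"
    and C: "real_mat (Delta Cm Cp) \<or> imag_mat (Delta Cm Cp)"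
    and s: "transfer_defined Cm Cp Om Op s"
  shows "Jmat ** transfer_matrix S Cm Cp Om Op s ** Jmat = - transfer_matrix S Cm Cp Om Op s"
proof -
  define A where "A = quad_A_complex Cm Cp Om Op"
  define B where "B = quad_B_complex S Cm Cp"
  define C where "C = quad_C_complex Cm Cp"
  define D where "D = quad_D_complex S"
  define R where "R = matrix_inv (mat s - A)"
  note cnj = S[unfolded imag_mat_iff_mat_cnj] Om[unfolded imag_mat_Delta]
    assms(3)[unfolded imag_mat_Delta real_mat_Delta]
  have A: "Jmat ** A ** Jmat = A"
    using cnj by (auto simp: A_def Jmat_quad_A_complex quad_A_complex_uminus_C)
  have D: "Jmat ** D ** Jmat = - D"
    using cnj by (simp add: D_def Jmat_quad_D_complex quad_D_complex_uminus)
  \<comment> \<open>The imaginary \<open>S\<close> contributes one sign to \<open>B\<close>. A real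
    coupling adds none; an imaginary one cancels that sign and makes \<open>C\<close> odd
    instead.\<close>
  have BC: "Jmat ** B ** Jmat = - B \<and> Jmat ** C ** Jmat = C
      \<or> Jmat ** B ** Jmat = B \<and> Jmat ** C ** Jmat = - C"
    using cnj by (auto simp: B_def C_def Jmat_quad_B_complex Jmat_quad_C_complex
        quad_B_complex_uminus quad_C_complex_uminus)
  have "Jmat ** (mat s - A) ** Jmat = Jmat ** mat s ** Jmat - Jmat ** A ** Jmat"
    by (simp add: matrix_mul_diff)
  also have "Jmat ** mat s ** Jmat = mat s ** (Jmat ** Jmat)"
    by (simp add: mat_mult_left mat_mult_right mat_scale_mult)
  finally have R: "Jmat ** R ** Jmat = R"
    using s unfolding R_def
    by (intro matrix_inv_conj_involution) (simp_all add: transfer_defined_def quad_real A Jmat_Jmat A_def[symmetric])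
  have JJ: "X ** Jmat ** Jmat = X" for X :: "complex ^ ('x::finite + 'x) ^ 'y"
    by (simp add: Jmat_Jmat flip: matrix_mul_assoc)
  \<comment> \<open>Inserting \<open>Jmat ** Jmat = mat 1\<close> between neighbouring factors lets
    the parities multiply.\<close>
  have "Jmat ** (C ** R ** B) ** Jmat
      = (Jmat ** C ** Jmat) ** (Jmat ** R ** Jmat) ** (Jmat ** B ** Jmat)"
    by (simp only: matrix_mul_assoc JJ)
  then have "Jmat ** (C ** R ** B) ** Jmat = - (C ** R ** B)"
    using BC R by (auto simp: matrix_mul_uminus)
  then show ?thesis
    unfolding transfer_matrix_def quad_real A_def[symmetric] B_def[symmetric] C_def[symmetric]
      D_def[symmetric] R_def[symmetric]
    by (simp add: matrix_add_ldistrib matrix_add_rdistrib D)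
qed

section \<open>Observability\<close>

lemma observable_pair_iff_span:
  "observable_pair A C \<longleftrightarrow> vec.span (observability_rows A C) = UNIV"
  for A :: "'a::field ^ 'k ^ 'k"
  unfolding observable_pair_def
  by (metis vec.dim_eq_full vec.dimension_def card_cart_basis)

lemma rows_matrix_mult: "rows (M ** T) = (\<lambda>v. v v* T) ` rows M"
  by (auto simp: rows_def row_def vec_eq_iff matrix_matrix_mult_def vector_matrix_mult_def image_iff
      mult.commute)

lemma mat_pow_uminus: "mat_pow (- A) j = mat_scale ((- 1) ^ j) (mat_pow A j)"
  for A :: "'a::comm_ring_1 ^ 'k ^ 'k"
proof (induction j)
  case 0
  show ?case by (simp add: vec_eq_iff mat_scale_def)
next
  case (Suc j)
  then show ?case
    by (simp add: mat_scale_mult matrix_mul_uminus) (simp add: vec_eq_iff mat_scale_def)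
qed

text \<open>Powers of \<open>- A\<close> and \<open>A\<close> differ by \<open>(- 1) ^ j\<close>,
  which leaves spans of rows unchanged. This disposes of the sign in iW = -Im W for imaginary
  W.\<close>

lemma observable_pair_uminus:
  fixes A :: "'a::field ^ 'k ^ 'k"
  assumes "observable_pair A C"
  shows "observable_pair (- A) C"
proof -
  have "observability_rows A C \<subseteq> vec.span (observability_rows (- A) C)"
  proof
    fix v assume "v \<in> observability_rows A C"
    then obtain j i where j: "j < CARD('k)" and v: "v = row i (C ** mat_pow A j)"
      by (auto simp: observability_rows_def rows_def)
    have "mat_pow A j = mat_scale ((- 1) ^ j) (mat_pow (- A) j)"
      using mat_pow_uminus[of "- A" j] by simp
    then have "v = (- 1) ^ j *s row i (C ** mat_pow (- A) j)"
      by (simp add: v mat_scale_mult) (simp add: vec_eq_iff row_def mat_scale_def)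
    moreover have "row i (C ** mat_pow (- A) j) \<in> observability_rows (- A) C"
      using j by (auto simp: observability_rows_def rows_def)
    ultimately show "v \<in> vec.span (observability_rows (- A) C)"
      by (simp add: vec.span_scale vec.span_base)
  qed
  then show ?thesis
    using assms unfolding observable_pair_iff_span
    by (metis vec.span_minimal vec.subspace_span top.extremum_uniqueI)
qed

section \<open>From complex to real observability\<close>

lemma mat_of_real_mult: "mat_of_real (A ** B) = mat_of_real A ** mat_of_real B"
  by (simp add: vec_eq_iff mat_of_real_def matrix_matrix_mult_def)

lemma mat_of_real_mat_pow: "mat_of_real (mat_pow A j) = mat_pow (mat_of_real A) j"
proof (induction j)
  case 0
  show ?case by (simp add: vec_eq_iff mat_of_real_def mat_def)
next
  case (Suc j)
  then show ?case by (simp add: mat_of_real_mult)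
qed

lemma linear_vector_matrix_mult: "Vector_Spaces.linear (*s) (*s) (\<lambda>v. v v* T)"
  for T :: "'a::field ^ 'k ^ 'l"
proof -
  have "(\<lambda>v. v v* T) = (*v) (transpose T)" by (simp add: fun_eq_iff)
  then show ?thesis by (simp only: matrix_vector_mul_linear_gen)
qed

text \<open>Right multiplication acts on each row by one linear map, and linear images commute with
  spans.\<close>

lemma vec_span_rows_matrix_mult:
  "vec.span (rows (M ** T)) = (\<lambda>v. v v* T) ` vec.span (rows M)"
  for M :: "'a::field ^ 'k ^ 'l"
  by (simp add: rows_matrix_mult vec.linear_span_image[OF linear_vector_matrix_mult])

lemma vec_span_rows_mult_mono:
  fixes M :: "'a::field ^ 'k ^ 'l"
  assumes "rows N \<subseteq> vec.span (rows M)"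
  shows "rows (N ** T) \<subseteq> vec.span (rows (M ** T))"
  unfolding vec_span_rows_matrix_mult rows_matrix_mult[of N] using assms by blast

definition mat_Im :: "complex ^ 'c ^ 'r \<Rightarrow> real ^ 'c ^ 'r" where
  "mat_Im = map_matrix Im"

lemma mat_Re_Im_mult_mat_of_real:
  "mat_Re (C ** mat_of_real F) = mat_Re C ** F" "mat_Im (C ** mat_of_real F) = mat_Im C ** F"
  by (simp_all add: vec_eq_iff mat_Re_def mat_Im_def mat_of_real_def matrix_matrix_mult_def)

text \<open>Since \<open>F\<close> is real, real and imaginary parts of rows of
  \<open>C ** mat_pow (mat_of_real F) j\<close> are rows of \<open>mat_Re C ** mat_pow F j\<close>
  and \<open>mat_Im C ** mat_pow F j\<close>, hence lie in the real span of the rows for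
  \<open>K\<close>.\<close>

lemma observable_pair_of_real:
  fixes F :: "real ^ 'k ^ 'k" and K :: "real ^ 'k ^ 'y" and C :: "complex ^ 'k ^ 'l"
  assumes obs: "observable_pair (mat_of_real F) C"
    and Re: "rows (mat_Re C) \<subseteq> vec.span (rows K)" and Im: "rows (mat_Im C) \<subseteq> vec.span (rows K)"
  shows "observable_pair F K"
proof -
  define re im :: "complex ^ 'k \<Rightarrow> real ^ 'k"
    where "re v = (\<chi> l. Re (v $ l))" and "im v = (\<chi> l. Im (v $ l))" for v
  let ?V = "vec.span (observability_rows F K)"
  have rows: "re v \<in> ?V \<and> im v \<in> ?V"
    if "v \<in> observability_rows (mat_of_real F) C" for v
  proof -
    from that obtain j i where j: "j < CARD('k)" and v: "v = row i (C ** mat_pow (mat_of_real F) j)"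
      by (auto simp: observability_rows_def rows_def)
    have "re v = row i (mat_Re C ** mat_pow F j)" "im v = row i (mat_Im C ** mat_pow F j)"
      unfolding v mat_of_real_mat_pow[symmetric] mat_Re_Im_mult_mat_of_real[symmetric]
      by (simp_all add: re_def im_def row_def mat_Re_def mat_Im_def vec_eq_iff)
    then have "re v \<in> rows (mat_Re C ** mat_pow F j)" "im v \<in> rows (mat_Im C ** mat_pow F j)"
      by (auto simp: rows_def)
    then have "re v \<in> vec.span (rows (K ** mat_pow F j))" "im v \<in> vec.span (rows (K ** mat_pow F j))"
      using vec_span_rows_mult_mono[OF Re] vec_span_rows_mult_mono[OF Im] by blast+
    moreover have "vec.span (rows (K ** mat_pow F j)) \<subseteq> ?V"
      using j by (intro vec.span_mono) (auto simp: observability_rows_def)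
    ultimately show ?thesis by blast
  qed
  \<comment> \<open>A complex scalar mixes real and imaginary parts, so the induction carries both
    memberships together.\<close>
  have span: "re v \<in> ?V \<and> im v \<in> ?V"
    if "v \<in> vec.span (observability_rows (mat_of_real F) C)" for v
    using that
  proof (induction rule: vec.span_induct_alt)
    case base
    have "re 0 = 0" "im 0 = 0" by (simp_all add: re_def im_def vec_eq_iff)
    then show ?case by (simp add: vec.span_zero)
  next
    case (step c x y)
    have "re (c *s x + y) = Re c *s re x - Im c *s im x + re y"
      "im (c *s x + y) = Re c *s im x + Im c *s re x + im y"
      by (simp_all add: re_def im_def vec_eq_iff)
    then show ?case
      using rows[OF step(1)] step(2)
      by (simp add: vec.span_add vec.span_diff vec.span_scale)
  qed
  \<comment> \<open>A real vector is the real part of its complexification, which lies in the full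
    complex span.\<close>
  have "v \<in> ?V" for v
  proof -
    have "re (\<chi> l. complex_of_real (v $ l)) = v" by (simp add: re_def vec_eq_iff)
    then show ?thesis
      using span obs unfolding observable_pair_iff_span by (metis UNIV_I)
  qed
  then show ?thesis unfolding observable_pair_iff_span by blast
qed

section \<open>Autonomous variables that determine the output\<close>

text \<open>The output sees \<open>x\<close> only through \<open>T\<close>, so the observability
  rows of \<open>(F, K)\<close>, multiplied by \<open>T\<close>, are observability rows of
  \<open>(A, C)\<close>. The former span everything, and the rows of \<open>T\<close> are the images
  of the unit vectors.\<close>

lemma QND_variable_if_observable:
  fixes A :: "real ^ 'k ^ 'k" and T :: "real ^ 'k ^ 'n"
  assumes A: "T ** A = F ** T" and B: "T ** B = 0" and C: "C = K ** T"
    and obs: "observable_pair F K" and card: "CARD('n) \<le> CARD('k)"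
  shows "QND_variable A B C T"
proof -
  have TA: "T ** mat_pow A j = mat_pow F j ** T" for j
  proof (induction j)
    case (Suc j)
    then show ?case by simp (metis A matrix_mul_assoc)
  qed simp
  have "C ** mat_pow A j = (K ** mat_pow F j) ** T" for j
    by (metis C TA matrix_mul_assoc)
  \<comment> \<open>The powers run below \<open>CARD('n)\<close> for \<open>F\<close> and below
    \<open>CARD('k)\<close> for \<open>A\<close>; \<open>card\<close> puts the first range inside
    the second.\<close>
  then have sub: "(\<lambda>v. v v* T) ` observability_rows F K \<subseteq> observability_rows A C"
    using card by (fastforce simp: observability_rows_def rows_matrix_mult)
  have "rows T = (\<lambda>v. v v* T) ` rows (mat 1 :: real ^ 'n ^ 'n)"
    using rows_matrix_mult[of "mat 1" T] by simp
  also have "\<dots> \<subseteq> (\<lambda>v. v v* T) ` vec.span (observability_rows F K)"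
    using obs by (auto simp: observable_pair_iff_span)
  also have "\<dots> = vec.span ((\<lambda>v. v v* T) ` observability_rows F K)"
    by (simp add: vec.linear_span_image[OF linear_vector_matrix_mult])
  also have "\<dots> \<subseteq> vec.span (observability_rows A C)"
    by (rule vec.span_mono[OF sub])
  finally show ?thesis
    using A B by (auto simp: QND_variable_def)
qed

section \<open>Systems with one quadrature coupled to the environment\<close>

lemma q_select_mult: "q_select ** M = (\<chi> i j. M $ Inl i $ j)"
  by (simp add: vec_eq_iff q_select_def matrix_matrix_mult_def if_distrib if_distribR cong: if_cong)

lemma p_select_mult: "p_select ** M = (\<chi> i j. M $ Inr i $ j)"
  by (simp add: vec_eq_iff p_select_def matrix_matrix_mult_def if_distrib if_distribR cong: if_cong)

lemma mult_q_select: "M ** q_select = (\<chi> i j. case j of Inl l \<Rightarrow> M $ i $ l | Inr l \<Rightarrow> 0)"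
  by (simp add: vec_eq_iff q_select_def matrix_matrix_mult_def if_distrib cong: if_cong split: sum.split)

lemma mult_p_select: "M ** p_select = (\<chi> i j. case j of Inl l \<Rightarrow> 0 | Inr l \<Rightarrow> M $ i $ l)"
  by (simp add: vec_eq_iff p_select_def matrix_matrix_mult_def if_distrib cong: if_cong split: sum.split)

lemma mat_Re_mat_of_real: "mat_Re (mat_of_real M) = M"
  by (simp add: vec_eq_iff mat_Re_def mat_of_real_def)

text \<open>The upper blocks are \<open>dagger Cm ** Cm - transpose Cp ** mat_cnj Cp\<close> and
  \<open>dagger Cm ** Cp - transpose Cp ** mat_cnj Cm\<close>. Under the sign assumptions the two
  terms of each difference coincide.\<close>

lemma flat_adj_Delta_mult_eq_0:
  assumes Cp: "Cp = Cm \<or> Cp = - Cm" and Cm: "mat_cnj Cm = Cm \<or> mat_cnj Cm = - Cm"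
  shows "flat_adj (Delta Cm Cp) ** Delta Cm Cp = 0"
proof -
  have t: "transpose (- X) = - transpose X" for X :: "complex ^ 'x ^ 'y"
    by (simp add: vec_eq_iff transpose_def)
  have z: "Delta 0 0 = 0"
    by (auto simp: vec_eq_iff Delta_def block_mat_def mat_cnj_def split: sum.splits)
  show ?thesis
    using assms by (auto simp: flat_adj_Delta Delta_mult dagger_def t matrix_mul_uminus mat_cnj_uminus z)
qed

text \<open>Only the Hamiltonian term survives. Its off-diagonal blocks are built from real parts of
  \<open>Om\<close> and \<open>Op\<close>, which vanish, so the two quadratures decouple.\<close>

lemma quad_A_if_flat_adj_eq_0:
  fixes Cm Cp :: "complex ^ 'n ^ 'm"
  assumes "flat_adj (Delta Cm Cp) ** Delta Cm Cp = 0" and "imag_mat (Delta Om Op)"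
  shows "quad_A Cm Cp Om Op = block_mat (mat_Im (Om + Op)) 0 0 (mat_Im (Om - Op))"
proof -
  have "mat_scale (1 / 2) 0 = (0 :: complex ^ ('n + 'n) ^ ('n + 'n))"
    by (simp add: vec_eq_iff mat_scale_def)
  then have "quad_A_complex Cm Cp Om Op
      = Vmat ** Delta (mat_scale (- \<i>) Om) (mat_scale (- \<i>) Op) ** dagger Vmat"
    unfolding quad_A_complex_def minus_i_Jmat_Delta using assms(1) by simp
  moreover have "Re (Om $ i $ j) = 0" "Re (Op $ i $ j) = 0" for i j
    using assms(2) by (auto simp: imag_mat_Delta simp flip: imag_mat_iff_mat_cnj) (auto simp: imag_mat_def)
  ultimately show ?thesis
    by (simp add: quad_A_def Vmat_Delta_Vmat mat_Re_mat_of_real)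
       (simp add: vec_eq_iff block_mat_def mat_Im_def mat_scale_def split: sum.splits)
qed

text \<open>For \<open>Cp = Cm\<close> the second argument of \<open>Delta\<close> is minus the
  conjugate of the first, which cancels the upper block row; for \<open>Cp = - Cm\<close> it is the
  conjugate, which cancels the lower one.\<close>

lemma quad_B_eq:
  "quad_B S Cm Cp = mat_Re (- (Vmat ** Delta (dagger Cm ** S) (- mat_cnj (dagger Cp ** S)) ** dagger Vmat))"
proof -
  have "mat_cnj (dagger Cp) = transpose Cp"
    by (simp add: vec_eq_iff mat_cnj_def dagger_def transpose_def)
  then show ?thesis by (simp add: quad_B_def quad_B_complex_alt mat_cnj_mult)
qed

lemma quad_C_block_mat:
  "quad_C Cm Cp = block_mat (mat_Re (Cm + Cp)) (mat_Im (Cp - Cm)) (mat_Im (Cm + Cp)) (mat_Re (Cm - Cp))"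
  by (simp add: quad_C_def quad_C_complex_def Vmat_Delta_Vmat mat_Re_mat_of_real)
     (simp add: vec_eq_iff block_mat_def mat_Re_def mat_Im_def split: sum.splits)

lemma row_in_span_if_scaled_row:
  fixes K :: "real ^ 'k ^ 'y" and M :: "real ^ 'k ^ 'l"
  assumes "c \<noteq> 0" and "\<And>i. row (h i) K = c *s row i M"
  shows "rows M \<subseteq> vec.span (rows K)"
proof
  fix v assume "v \<in> rows M"
  then obtain i where v: "v = row i M" by (auto simp: rows_def)
  have "v = inverse c *s row (h i) K"
    using assms by (simp add: v vec_eq_iff)
  moreover have "row (h i) K \<in> rows K" by (auto simp: rows_def)
  ultimately show "v \<in> vec.span (rows K)" by (simp add: vec.span_scale vec.span_base)
qed

text \<open>For imaginary \<open>W\<close> the matrix \<open>mat_scale \<i> W\<close> is real and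
  equals minus \<open>mat_Im W\<close>. The nonzero factors \<open>c\<close> and \<open>d\<close> do
  not change the row span, and \<open>h\<close>, \<open>g\<close> locate the two parts of
  \<open>Cm\<close> inside \<open>K\<close>.\<close>

lemma observable_pair_stacked:
  fixes Cm :: "complex ^ 'n ^ 'm" and W :: "complex ^ 'n ^ 'n" and K :: "real ^ 'n ^ ('m + 'm)"
  assumes obs: "observable_pair (mat_scale \<i> W) Cm" and W: "imag_mat W"
    and "c \<noteq> 0" "d \<noteq> 0"
    and K: "\<And>i. row (h i) K = c *s row i (mat_Re Cm)" "\<And>i. row (g i) K = d *s row i (mat_Im Cm)"
  shows "observable_pair (mat_Im W) K"
proof (rule observable_pair_of_real)
  have "mat_of_real (mat_Im W) = - mat_scale \<i> W"
    using W by (simp add: vec_eq_iff mat_of_real_def mat_Im_def mat_scale_def imag_mat_def complex_eq_iff)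
  then show "observable_pair (mat_of_real (mat_Im W)) Cm"
    using observable_pair_uminus[OF obs] by simp
qed (use assms row_in_span_if_scaled_row in blast)+

section \<open>QND property of the coupled quadrature\<close>

lemma QND_variable_q:
  fixes S :: "complex ^ 'm ^ 'm" and Cm :: "complex ^ 'n ^ 'm"
  assumes Om: "imag_mat (Delta Om Op)" and C: "mat_cnj Cm = Cm \<or> mat_cnj Cm = - Cm"
    and obs: "observable_pair (mat_scale \<i> (Om + Op)) Cm"
  shows "QND_variable (quad_A Cm Cm Om Op) (quad_B S Cm Cm) (quad_C Cm Cm) q_select"
proof (rule QND_variable_if_observable)
  \<comment> \<open>This is the left block column of the output matrix, from \<open>Cm + Cm\<close>;
    the right one vanishes.\<close>
  let ?K = "\<chi> i. case i of Inl k \<Rightarrow> 2 *s row k (mat_Re Cm) | Inr k \<Rightarrow> 2 *s row k (mat_Im Cm)"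
  have A: "quad_A Cm Cm Om Op = block_mat (mat_Im (Om + Op)) 0 0 (mat_Im (Om - Op))"
    by (intro quad_A_if_flat_adj_eq_0 flat_adj_Delta_mult_eq_0 Om C) simp
  show "q_select ** quad_A Cm Cm Om Op = mat_Im (Om + Op) ** q_select"
    by (simp add: A q_select_mult mult_q_select block_mat_def vec_eq_iff split: sum.split)
  show "q_select ** quad_B S Cm Cm = 0"
    by (simp add: q_select_mult quad_B_eq Vmat_Delta_Vmat mat_Re_def mat_of_real_def block_mat_def
        mat_cnj_def vec_eq_iff split: sum.splits)
  show "quad_C Cm Cm = ?K ** q_select"
    by (simp add: quad_C_block_mat mult_q_select block_mat_def vec_eq_iff row_def mat_Re_def mat_Im_def
        split: sum.splits)
  have "imag_mat (Om + Op)"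
    using Om by (auto simp: imag_mat_Delta simp flip: imag_mat_iff_mat_cnj) (auto simp: imag_mat_def)
  then show "observable_pair (mat_Im (Om + Op)) ?K"
    by (rule observable_pair_stacked[OF obs, where h = Inl and g = Inr and c = 2 and d = 2])
       (simp_all add: row_def vec_eq_iff)
qed simp

lemma QND_variable_p:
  fixes S :: "complex ^ 'm ^ 'm" and Cm :: "complex ^ 'n ^ 'm"
  assumes Om: "imag_mat (Delta Om Op)" and C: "mat_cnj Cm = Cm \<or> mat_cnj Cm = - Cm"
    and obs: "observable_pair (mat_scale \<i> (Om - Op)) Cm"
  shows "QND_variable (quad_A Cm (- Cm) Om Op) (quad_B S Cm (- Cm)) (quad_C Cm (- Cm)) p_select"
proof (rule QND_variable_if_observable)
  \<comment> \<open>Now the right block column survives. Its upper half comes from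
    \<open>Cp - Cm = - 2 Cm\<close>, hence the sign, and the real part sits in the lower
    half.\<close>
  let ?K = "\<chi> i. case i of Inl k \<Rightarrow> (- 2) *s row k (mat_Im Cm) | Inr k \<Rightarrow> 2 *s row k (mat_Re Cm)"
  have A: "quad_A Cm (- Cm) Om Op = block_mat (mat_Im (Om + Op)) 0 0 (mat_Im (Om - Op))"
    by (intro quad_A_if_flat_adj_eq_0 flat_adj_Delta_mult_eq_0 Om C) simp
  show "p_select ** quad_A Cm (- Cm) Om Op = mat_Im (Om - Op) ** p_select"
    by (simp add: A p_select_mult mult_p_select block_mat_def vec_eq_iff split: sum.split)
  have "dagger (- Cm) ** S = - (dagger Cm ** S)"
    unfolding matrix_mul_uminus(1)[symmetric]
    by (rule arg_cong[where f = "\<lambda>X. X ** S"])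
       (simp add: vec_eq_iff dagger_def mat_cnj_def transpose_def)
  then show "p_select ** quad_B S Cm (- Cm) = 0"
    by (simp add: p_select_mult quad_B_eq Vmat_Delta_Vmat mat_Re_def mat_of_real_def block_mat_def
        mat_cnj_def vec_eq_iff split: sum.splits)
  show "quad_C Cm (- Cm) = ?K ** p_select"
    by (simp add: quad_C_block_mat mult_p_select block_mat_def vec_eq_iff row_def mat_Re_def mat_Im_def
        split: sum.splits)
  have "imag_mat (Om - Op)"
    using Om by (auto simp: imag_mat_Delta simp flip: imag_mat_iff_mat_cnj) (auto simp: imag_mat_def)
  then show "observable_pair (mat_Im (Om - Op)) ?K"
    by (rule observable_pair_stacked[OF obs, where h = Inr and g = Inl and c = 2 and d = "- 2"])
       (simp_all add: row_def vec_eq_iff)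
qed simp

section \<open>BAE measurements and QND variables from parity and observability\<close>

theorem theorem2:
  fixes S :: "complex ^ 'm ^ 'm"
    and Cm Cp :: "complex ^ 'n ^ 'm"
    and Om Op :: "complex ^ 'n ^ 'n"
  assumes "linear_quantum_system S Cm Cp Om Op"
    and "imag_mat S" and "imag_mat (Delta Om Op)"
    and "real_mat (Delta Cm Cp) \<or> imag_mat (Delta Cm Cp)"
  shows "BAE_q_out_wrt_q_in S Cm Cp Om Op \<and>
         BAE_p_out_wrt_p_in S Cm Cp Om Op \<and>
         (Cm = Cp \<longrightarrow> observable_pair (mat_scale \<i> (Om + Op)) Cm \<longrightarrow>
           QND_variable (quad_A Cm Cp Om Op) (quad_B S Cm Cp) (quad_C Cm Cp) q_select) \<and>
         (Cm = - Cp \<longrightarrow> observable_pair (mat_scale \<i> (Om - Op)) Cm \<longrightarrow>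
           QND_variable (quad_A Cm Cp Om Op) (quad_B S Cm Cp) (quad_C Cm Cp) p_select)"
proof (intro conjI impI)
  note odd = transfer_matrix_odd[OF assms(2-4)]
  show "BAE_q_out_wrt_q_in S Cm Cp Om Op"
    by (simp add: BAE_q_out_wrt_q_in_def block_diag_eq_0_if_odd odd)
  show "BAE_p_out_wrt_p_in S Cm Cp Om Op"
    by (simp add: BAE_p_out_wrt_p_in_def block_diag_eq_0_if_odd odd)
  have C: "mat_cnj Cm = Cm \<or> mat_cnj Cm = - Cm"
    using assms(4) by (auto simp: real_mat_Delta imag_mat_Delta)
  show "QND_variable (quad_A Cm Cp Om Op) (quad_B S Cm Cp) (quad_C Cm Cp) q_select"
    if "Cm = Cp" "observable_pair (mat_scale \<i> (Om + Op)) Cm"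
    using QND_variable_q[OF assms(3) C that(2)] that(1) by simp
  show "QND_variable (quad_A Cm Cp Om Op) (quad_B S Cm Cp) (quad_C Cm Cp) p_select"
    if "Cm = - Cp" "observable_pair (mat_scale \<i> (Om - Op)) Cm"
    using QND_variable_p[OF assms(3) C that(2)] that(1) by simp
qed

end
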